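(* Let $\mu$ and $\nu$ be two probability measures, and let $H$ be a bipartite graph such that $\|\cdot\|_{r(H)}$ is a norm. Then for every subgraph $G\subseteq H$ (with at least one edge) and every $w\in\mathcal{W}(\mu\times\nu)$ we have $$\|w\|_{r(H)}\ge\|w\|_{r(G)}.$$
   Context: A bipartite graph is a triple $H=(X,Y;E)$ where $X,Y$ are disjoint finite sets and $E$ is a finite multi-set of elements of $X\times Y$ (multiple edges are allowed; the bipartization $(X,Y)$ is fixed, and a subgraph inherits it). For probability spaces $(M,\mathcal{F},\mu)$ and $(M',\mathcal{F}',\nu)$, $\mathcal{W}(\mu\times\nu)$ is the set of measurable functions $w:M\times M'\to\mathbb{R}$. For a bipartite graph $H=(X,Y;E)$ and $w\in\mathcal{W}(\mu\times\nu)$ put $$h_H(w)=\int\prod_{(u,v)\in E}w(x_u,y_v)\prod_{t\in X}d\mu(x_t)\prod_{r\in Y}d\nu(y_r),\qquad \|w\|_{r(H)}=|h_H(|w|)|^{1/|E|},$$ where $|w|$ is the pointwise absolute value (values in $[0,\infty]$ are allowed). $\mathcal{W}_{r(H)}(\mu\times\nu)$ is the set of $w\in\mathcal{W}(\mu\times\nu)$ with $\|w\|_{r(H)}<\infty$. The hypothesis "$\|\cdot\|_{r(H)}$ is a norm" means that it is always a norm: for all probability measures $\mu',\nu'$, $\|\cdot\|_{r(H)}$ is a norm on $\mathcal{W}_{r(H)}(\mu'\times\nu')$ (functions equal almost everywhere being identified, as usual). *)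

theory Defs
  imports "HOL-Probability.Probability"
begin

record 'v bigraph =
  lverts :: "'v set"
  rverts :: "'v set"
  bedges :: "('v \<times> 'v) multiset"

definition bipartite_graph :: "'v bigraph \<Rightarrow> bool" where
  "bipartite_graph H \<longleftrightarrow>
     finite (lverts H) \<and> finite (rverts H) \<and> lverts H \<inter> rverts H = {} \<and>
     set_mset (bedges H) \<subseteq> lverts H \<times> rverts H"

definition bipartite_subgraph :: "'v bigraph \<Rightarrow> 'v bigraph \<Rightarrow> bool" where
  "bipartite_subgraph G H \<longleftrightarrow>
     bipartite_graph G \<and> bipartite_graph H \<and>
     lverts G \<subseteq> lverts H \<and> rverts G \<subseteq> rverts H \<and> bedges G \<subseteq># bedges H"

(* The functional h_H is only ever applied to pointwise absolute values, so it is defined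
   on functions with values in [0,\<infinity>], where the integral always exists. *)
definition hom_integral ::
  "'v bigraph \<Rightarrow> 'a measure \<Rightarrow> 'b measure \<Rightarrow> ('a \<times> 'b \<Rightarrow> ennreal) \<Rightarrow> ennreal" where
  "hom_integral H \<mu> \<nu> f =
     (\<integral>\<^sup>+ (x, y). (\<Prod>e\<in>#bedges H. f (x (fst e), y (snd e)))
        \<partial>((\<Pi>\<^sub>M t\<in>lverts H. \<mu>) \<Otimes>\<^sub>M (\<Pi>\<^sub>M r\<in>rverts H. \<nu>)))"

(* Real powers on [0,\<infinity>]; intended for exponents p > 0. *)
definition ennreal_powr :: "ennreal \<Rightarrow> real \<Rightarrow> ennreal" where
  "ennreal_powr a p = (if a = \<infinity> then \<infinity> else ennreal (enn2real a powr p))"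

definition rnorm ::
  "'v bigraph \<Rightarrow> 'a measure \<Rightarrow> 'b measure \<Rightarrow> ('a \<times> 'b \<Rightarrow> real) \<Rightarrow> ennreal" where
  "rnorm H \<mu> \<nu> w =
     ennreal_powr (hom_integral H \<mu> \<nu> (\<lambda>z. ennreal \<bar>w z\<bar>)) (1 / real (size (bedges H)))"

definition rspace ::
  "'v bigraph \<Rightarrow> 'a measure \<Rightarrow> 'b measure \<Rightarrow> ('a \<times> 'b \<Rightarrow> real) set" where
  "rspace H \<mu> \<nu> = {w \<in> borel_measurable (\<mu> \<Otimes>\<^sub>M \<nu>). rnorm H \<mu> \<nu> w < \<infinity>}"

(* Functions equal almost everywhere are identified, so definiteness is stated modulo null sets.
   Closure of the space under sums and scalar multiples follows from the inequalities, because
   rnorm is defined, possibly as \<infinity>, for every function. *)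
definition is_norm_rspace :: "'v bigraph \<Rightarrow> 'a measure \<Rightarrow> 'b measure \<Rightarrow> bool" where
  "is_norm_rspace H \<mu> \<nu> \<longleftrightarrow>
     (\<forall>w\<in>rspace H \<mu> \<nu>. rnorm H \<mu> \<nu> w = 0 \<longleftrightarrow> (AE z in \<mu> \<Otimes>\<^sub>M \<nu>. w z = 0)) \<and>
     (\<forall>c. \<forall>w\<in>rspace H \<mu> \<nu>. rnorm H \<mu> \<nu> (\<lambda>z. c * w z) = ennreal \<bar>c\<bar> * rnorm H \<mu> \<nu> w) \<and>
     (\<forall>w\<in>rspace H \<mu> \<nu>. \<forall>w'\<in>rspace H \<mu> \<nu>.
        rnorm H \<mu> \<nu> (\<lambda>z. w z + w' z) \<le> rnorm H \<mu> \<nu> w + rnorm H \<mu> \<nu> w')"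

(* "Is a norm" means: is a norm for every pair of probability spaces.  A formula cannot quantify
   over types, so the spaces range over all probability measures, on arbitrary sigma-algebras,
   over sets of reals.  Requiring less of H only makes a theorem that assumes this property
   stronger.  Nothing is lost: functions that are measurable on an arbitrary product space
   factor through maps M \<rightarrow> R and M' \<rightarrow> R. *)
definition always_norm :: "'v bigraph \<Rightarrow> bool" where
  "always_norm H \<longleftrightarrow>
     (\<forall>(\<mu> :: real measure) (\<nu> :: real measure).
        prob_space \<mu> \<longrightarrow> prob_space \<nu> \<longrightarrow> is_norm_rspace H \<mu> \<nu>)"

end

theory Submission
  imports Defs
begin

text \<open>
  Write $h_K(f)$ for the integral that defines $\|\cdot\|_{r(K)}$, and let $G$ and $H$ have $k$ and
  $m$ edges. Suppose $\|w\|_{r(H)} \le t$ with $t > 0$; the aim is $h_G(|w|) \le t^k$.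
  Expanding the product over the edges of $H$ in $h_H(|w| + t)$ gives nonnegative terms, one of which
  is $h_G(|w|)\, t^{m-k}$: choose $|w|$ on the edges of $G$ and $t$ on the others. A constant
  function $t$ has norm $t$ on a probability space, so the triangle inequality gives
  $h_H(|w| + t) \le (2t)^m$. Hence $h_G(|w|) \le 2^m t^k$, which is the desired bound up to a constant
  that depends on $H$ alone (\<open>hom_integral_subgraph_le_const_mult\<close>).

  The constant is removed by the tensor power trick. The function
  $w \otimes w$ on $(\mu \times \mu) \times (\nu \times \nu)$ satisfies
  $h_K(|w \otimes w|) = h_K(|w|)^2$ for every $K$ (\<open>hom_integral_tensor_square\<close>), so the same crude
  bound, applied after $n$ squarings, reads $h_G(|w|)^{2^n} \le 2^m (t^k)^{2^n}$. Letting $n$ grow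
  yields $h_G(|w|) \le t^k$.

  The norm hypothesis concerns measures on the real line, whereas the given spaces and their squares
  are of other types. This is bridged by a coding: a measurable function on a product
  space depends on countably many measurable rectangles only, and countably many subsets of a space
  can be encoded in the digits of a single real-valued function. So $w = g \circ (\varphi \times \psi)$
  with real-valued $\varphi$, $\psi$, and the image measures under $\varphi$ and $\psi$ carry a
  function with the same integrals $h_K$ (\<open>hom_integral_realized_on_reals\<close>). Returning to the real
  line after each squaring is also what makes the squaring an induction over a single type.
\<close>

section \<open>Functions on a product space factor through the real plane\<close>

lemma countably_many_generators:
  assumes "S \<in> sigma_sets \<Omega> A"
  shows "\<exists>C\<subseteq>A. countable C \<and> S \<in> sigma_sets \<Omega> C"
  using assms
proof induction
  case (Basic a)
  then show ?case by (intro exI[of _ "{a}"]) auto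
next
  case Empty
  then show ?case by (intro exI[of _ "{}"]) (auto intro: sigma_sets.Empty)
next
  case (Compl a)
  then show ?case by (meson sigma_sets.Compl)
next
  case (Union a)
  then obtain C where C: "\<And>i. C i \<subseteq> A" "\<And>i. countable (C i)" "\<And>i::nat. a i \<in> sigma_sets \<Omega> (C i)"
    by metis
  have "a i \<in> sigma_sets \<Omega> (\<Union>i. C i)" for i
    using C(3)[of i] sigma_sets_mono'[of "C i" "\<Union>i. C i"] by blast
  with C show ?case
    by (intro exI[of _ "\<Union>i. C i"]) (auto intro: sigma_sets.Union)
qed

text \<open>
  The numbers $b_i \in \{0, 1\}$ are the base 4 digits of the sum, and the parity of the integer part
  after a shift by $n$ places reads off the $n$-th one. The digits 2 and 3 do not occur, so the tail
  after place $n$ is at most $1/3$ and no carry can disturb the digit; in base 2 the expansion would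
  not be unique.
\<close>
lemma odd_floor_base4:
  fixes b :: "nat \<Rightarrow> int"
  assumes b: "\<And>i. b i \<in> {0, 1}"
  shows "odd \<lfloor>4 ^ n * (\<Sum>i. of_int (b i) / 4 ^ i :: real)\<rfloor> \<longleftrightarrow> b n = 1"
proof -
  define c where "c i = (of_int (b i) / 4 ^ i :: real)" for i
  have b01: "0 \<le> b i" "b i \<le> 1" for i using b[of i] by auto
  have geo: "summable (\<lambda>i. (1 / 4 :: real) ^ i)" by simp
  have c_le: "0 \<le> c i" "c i \<le> (1 / 4) ^ i" for i
    using b01[of i] by (auto simp: c_def power_one_over divide_simps)
  have sum_c: "summable c"
    by (rule summable_comparison_test'[OF geo, of 0]) (use c_le in auto)
  define t where "t = 4 ^ n * (\<Sum>i. c (i + Suc n))"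
  have sum_s: "summable (\<lambda>i. c (i + Suc n))" using sum_c by (rule summable_ignore_initial_segment)
  have t0: "0 \<le> t" unfolding t_def using c_le sum_s by (intro mult_nonneg_nonneg suminf_nonneg) auto
  have tail: "c (i + Suc n) \<le> (1 / 4) ^ Suc n * (1 / 4) ^ i" for i
    using c_le(2)[of "i + Suc n"] by (simp only: power_add mult.commute)
  have "(\<Sum>i. c (i + Suc n)) \<le> (\<Sum>i. (1 / 4) ^ Suc n * (1 / 4 :: real) ^ i)"
    using sum_s tail by (intro suminf_le summable_mult geo)
  also have "\<dots> = (1 / 4) ^ Suc n * (4 / 3)"
    using geo by (subst suminf_mult) (simp_all add: suminf_geometric)
  finally have t1: "t < 1" unfolding t_def by (simp add: power_one_over field_simps)
  define k where "k = (\<Sum>i<n. 4 ^ (n - i) * b i)"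
  have "even k" unfolding k_def by (intro dvd_sum) auto
  have "4 ^ n * (\<Sum>i. c i) = 4 ^ n * (\<Sum>i<Suc n. c i) + t"
    unfolding t_def using suminf_split_initial_segment[OF sum_c, of "Suc n"] by (simp add: algebra_simps)
  also have "4 ^ n * (\<Sum>i<Suc n. c i) = of_int (k + b n)"
  proof -
    have "4 ^ n * c i = of_int (4 ^ (n - i) * b i)" if "i < n" for i
    proof -
      have "(4 :: real) ^ n = 4 ^ (n - i) * 4 ^ i" using that by (simp flip: power_add)
      then show ?thesis by (simp add: c_def)
    qed
    then show ?thesis by (simp add: k_def sum_distrib_left distrib_left c_def)
  qed
  finally have "\<lfloor>4 ^ n * (\<Sum>i. c i)\<rfloor> = k + b n" using t0 t1 by linarith
  then show ?thesis using \<open>even k\<close> b[of n] by (auto simp: c_def)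
qed

text \<open>
  A point $x$ is sent to the real number whose base 4 digits are the truth values of $x \in A_i$;
  the Borel set $B_i$ collects the numbers whose $i$-th digit is 1.
\<close>
lemma countably_many_sets_coded_by_real:
  fixes A :: "nat \<Rightarrow> 'a set"
  assumes A[measurable]: "\<And>i. A i \<in> sets M"
  obtains \<phi> :: "'a \<Rightarrow> real" and B :: "nat \<Rightarrow> real set" where
    "\<phi> \<in> borel_measurable M" "\<And>i. B i \<in> sets borel" "\<And>i. A i = \<phi> -` B i \<inter> space M"
proof
  let ?\<phi> = "\<lambda>x. \<Sum>i. of_int (indicator (A i) x) / 4 ^ i :: real"
  let ?B = "\<lambda>i. {r. odd \<lfloor>4 ^ i * r :: real\<rfloor>}"
  have "(\<lambda>x. of_int (indicator (A i) x) :: real) = indicator (A i)" for i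
    by (auto simp: indicator_def)
  then have [measurable]: "(\<lambda>x. of_int (indicator (A i) x) :: real) \<in> borel_measurable M" for i
    by simp
  show "?\<phi> \<in> borel_measurable M" by measurable
  show "?B i \<in> sets borel" for i
  proof -
    have "?B i = (\<lambda>r. \<lfloor>4 ^ i * r\<rfloor>) -` {k. odd k} \<inter> space borel" by auto
    also have "\<dots> \<in> sets borel"
      by (rule measurable_sets[of _ _ "count_space UNIV"]) simp_all
    finally show ?thesis .
  qed
  show "A i = ?\<phi> -` ?B i \<inter> space M" for i
  proof -
    have "odd \<lfloor>4 ^ i * ?\<phi> x\<rfloor> \<longleftrightarrow> x \<in> A i" for x
      by (subst odd_floor_base4) (auto simp: indicator_def)
    then show ?thesis using sets.sets_into_space[OF A[of i]] by auto
  qed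
qed

text \<open>
  The Doob--Dynkin lemma: a function measurable for the sigma-algebra generated by $T$ is a
  measurable function of $T$. Indicators have this form by definition, and the form is stable under
  the operations that build all nonnegative measurable functions from them.
\<close>
lemma measurable_vimage_algebra_factors:
  fixes f :: "'a \<Rightarrow> ennreal"
  assumes T: "T \<in> \<Omega> \<rightarrow> space N" and f: "f \<in> borel_measurable (vimage_algebra \<Omega> T N)"
  shows "\<exists>g\<in>borel_measurable N. \<forall>x\<in>\<Omega>. f x = g (T x)"
  using f
proof (induction rule: borel_measurable_induct)
  case (cong u v)
  then show ?case by simp
next
  case (set A)
  then obtain B where "B \<in> sets N" "A = T -` B \<inter> \<Omega>"
    using T by (auto simp: sets_vimage_algebra2)
  then show ?case by (intro bexI[of _ "indicator B"]) (auto simp: indicator_def)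
next
  case (mult u c)
  then obtain g where [measurable]: "g \<in> borel_measurable N" and "\<forall>x\<in>\<Omega>. u x = g (T x)" by blast
  then show ?case by (intro bexI[of _ "\<lambda>y. c * g y"]) auto
next
  case (add u v)
  then obtain g h where [measurable]: "g \<in> borel_measurable N" "h \<in> borel_measurable N"
    and "\<forall>x\<in>\<Omega>. u x = g (T x)" "\<forall>x\<in>\<Omega>. v x = h (T x)" by blast
  then show ?case by (intro bexI[of _ "\<lambda>y. h y + g y"]) auto
next
  case (seq U)
  then obtain g where [measurable]: "\<And>i. g i \<in> borel_measurable N"
    and g: "\<And>i. \<forall>x\<in>\<Omega>. U i x = g i (T x)"
    by metis
  have "(\<lambda>y. SUP i. g i y) \<in> borel_measurable N" by measurable
  then show ?case by (rule rev_bexI) (use g in \<open>simp add: image_image\<close>)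
qed

text \<open>
  The sigma-algebra generated by $f$ is generated by the preimages of a countable basis, each of which
  lies in the sigma-algebra of countably many rectangles $a \times b$. Coding all sides $a$ in
  one function $\varphi$ and all sides $b$ in one function $\psi$ makes $f$ measurable for the
  sigma-algebra generated by $\varphi \times \psi$.
\<close>
lemma borel_measurable_pair_factors_through_reals:
  fixes f :: "'a \<times> 'b \<Rightarrow> ennreal"
  assumes f: "f \<in> borel_measurable (M \<Otimes>\<^sub>M N)"
  obtains \<phi> :: "'a \<Rightarrow> real" and \<psi> :: "'b \<Rightarrow> real" and g :: "real \<times> real \<Rightarrow> ennreal" where
    "\<phi> \<in> borel_measurable M" "\<psi> \<in> borel_measurable N" "g \<in> borel_measurable (borel \<Otimes>\<^sub>M borel)"
    "\<And>x y. x \<in> space M \<Longrightarrow> y \<in> space N \<Longrightarrow> f (x, y) = g (\<phi> x, \<psi> y)"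
proof -
  let ?\<Omega> = "space M \<times> space N"
  define R where "R = {a \<times> b | a b. a \<in> sets M \<and> b \<in> sets N}"
  obtain D :: "ennreal set set" where D: "countable D" "topological_basis D"
    using ex_countable_basis by blast
  have "\<forall>d\<in>D. \<exists>C\<subseteq>R. countable C \<and> f -` d \<inter> ?\<Omega> \<in> sigma_sets ?\<Omega> C"
  proof (intro ballI countably_many_generators)
    fix d assume "d \<in> D"
    have "f -` d \<inter> space (M \<Otimes>\<^sub>M N) \<in> sets (M \<Otimes>\<^sub>M N)"
      by (rule measurable_sets[OF f]) (use D \<open>d \<in> D\<close> in \<open>auto simp: topological_basis_open\<close>)
    then show "f -` d \<inter> ?\<Omega> \<in> sigma_sets ?\<Omega> R"
      by (simp add: sets_pair_measure space_pair_measure R_def)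
  qed
  then obtain C where "\<forall>d\<in>D. C d \<subseteq> R \<and> countable (C d) \<and> f -` d \<inter> ?\<Omega> \<in> sigma_sets ?\<Omega> (C d)"
    by (rule bchoice[THEN exE])
  then have C: "\<And>d. d \<in> D \<Longrightarrow> C d \<subseteq> R" "\<And>d. d \<in> D \<Longrightarrow> countable (C d)"
    "\<And>d. d \<in> D \<Longrightarrow> f -` d \<inter> ?\<Omega> \<in> sigma_sets ?\<Omega> (C d)"
    by auto
  \<comment> \<open>The empty rectangle only ensures that E is nonempty and can be enumerated.\<close>
  define E where "E = insert ({} \<times> {}) (\<Union>d\<in>D. C d)"
  have "countable E" "E \<noteq> {}" "E \<subseteq> R"
    using C D(1) unfolding E_def by (auto simp: R_def)
  define e where "e = from_nat_into E"
  have e: "range e = E"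
    unfolding e_def using \<open>E \<noteq> {}\<close> \<open>countable E\<close> by (rule range_from_nat_into)
  have "\<forall>i. \<exists>a b. e i = a \<times> b \<and> a \<in> sets M \<and> b \<in> sets N"
  proof
    fix i
    have "e i \<in> R" using e \<open>E \<subseteq> R\<close> by auto
    then show "\<exists>a b. e i = a \<times> b \<and> a \<in> sets M \<and> b \<in> sets N" unfolding R_def by blast
  qed
  then obtain a b where "\<forall>i. e i = a i \<times> b i \<and> a i \<in> sets M \<and> b i \<in> sets N"
    unfolding choice_iff by blast
  then have ab: "\<And>i. e i = a i \<times> b i" "\<And>i. a i \<in> sets M" "\<And>i. b i \<in> sets N"
    by auto
  obtain \<phi> :: "'a \<Rightarrow> real" and P where \<phi>: "\<phi> \<in> borel_measurable M" "\<And>i. P i \<in> sets borel" "\<And>i. a i = \<phi> -` P i \<inter> space M"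
    by (rule countably_many_sets_coded_by_real[of a M, OF ab(2)]) blast
  obtain \<psi> :: "'b \<Rightarrow> real" and Q where \<psi>: "\<psi> \<in> borel_measurable N" "\<And>i. Q i \<in> sets borel" "\<And>i. b i = \<psi> -` Q i \<inter> space N"
    by (rule countably_many_sets_coded_by_real[of b N, OF ab(3)]) blast
  let ?T = "\<lambda>(x, y). (\<phi> x, \<psi> y)"
  let ?V = "vimage_algebra ?\<Omega> ?T (borel \<Otimes>\<^sub>M borel)"
  have "e i \<in> sets ?V" for i
  proof -
    have "?T -` (P i \<times> Q i) \<inter> ?\<Omega> \<in> sets ?V" using \<phi> \<psi> by (intro in_vimage_algebra) auto
    moreover have "?T -` (P i \<times> Q i) \<inter> ?\<Omega> = e i" using ab \<phi>(3) \<psi>(3) by auto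
    ultimately show ?thesis by simp
  qed
  then have "E \<subseteq> sets ?V" using e by blast
  then have sub: "sigma_sets ?\<Omega> E \<subseteq> sets ?V"
    using sets.sigma_sets_subset[of E ?V] by simp
  have "f \<in> borel_measurable ?V"
    unfolding borel_eq_countable_basis[OF D]
  proof (rule measurable_measure_of)
    fix d assume "d \<in> D"
    then have "f -` d \<inter> ?\<Omega> \<in> sigma_sets ?\<Omega> E"
      using C(3)[of d] sigma_sets_mono'[of "C d" E] by (auto simp: E_def)
    with sub show "f -` d \<inter> space ?V \<in> sets ?V" by auto
  qed auto
  from measurable_vimage_algebra_factors[OF _ this]
  obtain g where "g \<in> borel_measurable (borel \<Otimes>\<^sub>M borel)" "\<And>z. z \<in> ?\<Omega> \<Longrightarrow> f z = g (?T z)"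
    by (auto simp: space_pair_measure)
  with \<phi>(1) \<psi>(1) show ?thesis by (intro that) auto
qed

section \<open>Change of variables in homomorphism integrals\<close>

lemma borel_measurable_prod_mset_edges:
  fixes f :: "'a \<times> 'b \<Rightarrow> ennreal"
  assumes f[measurable]: "f \<in> borel_measurable (\<mu> \<Otimes>\<^sub>M \<nu>)" and E: "set_mset E \<subseteq> L \<times> R"
  shows "(\<lambda>(x, y). \<Prod>e\<in>#E. f (x (fst e), y (snd e)))
           \<in> borel_measurable ((\<Pi>\<^sub>M t\<in>L. \<mu>) \<Otimes>\<^sub>M (\<Pi>\<^sub>M r\<in>R. \<nu>))"
  using E
proof (induction E)
  case (add e E)
  then have "fst e \<in> L" "snd e \<in> R" by auto
  then have [measurable]: "(\<lambda>z. f (fst z (fst e), snd z (snd e)))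
      \<in> borel_measurable ((\<Pi>\<^sub>M t\<in>L. \<mu>) \<Otimes>\<^sub>M (\<Pi>\<^sub>M r\<in>R. \<nu>))"
    by measurable
  have [measurable]: "(\<lambda>z. \<Prod>e\<in>#E. f (fst z (fst e), snd z (snd e)))
      \<in> borel_measurable ((\<Pi>\<^sub>M t\<in>L. \<mu>) \<Otimes>\<^sub>M (\<Pi>\<^sub>M r\<in>R. \<nu>))"
    using add by (simp add: case_prod_unfold)
  show ?case by (simp add: case_prod_unfold)
qed simp

lemma bipartite_graph_edgeD:
  assumes "bipartite_graph G" "(a, b) \<in># bedges G"
  shows "a \<in> lverts G" "b \<in> rverts G"
  using assms by (auto simp: bipartite_graph_def)

text \<open>
  The common form of the three changes of variables below, in which the vertex spaces are images
  under a coordinatewise map, under restriction to fewer vertices, and under zipping two families.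
\<close>
lemma nn_integral_pair_of_images:
  fixes h :: "'c \<times> 'd \<Rightarrow> ennreal"
  assumes P: "P = distr M P f" "f \<in> measurable M P" and Q: "Q = distr N Q g" "g \<in> measurable N Q"
    and "sigma_finite_measure Q" and h: "h \<in> borel_measurable (P \<Otimes>\<^sub>M Q)"
  shows "(\<integral>\<^sup>+ z. h z \<partial>(P \<Otimes>\<^sub>M Q)) = (\<integral>\<^sup>+ (x, y). h (f x, g y) \<partial>(M \<Otimes>\<^sub>M N))"
proof -
  note [measurable] = P(2) Q(2)
  have "sigma_finite_measure (distr N Q g)" using assms(5) Q(1) by metis
  then have "distr M P f \<Otimes>\<^sub>M distr N Q g = distr (M \<Otimes>\<^sub>M N) (P \<Otimes>\<^sub>M Q) (\<lambda>(x, y). (f x, g y))"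
    using P(2) Q(2) by (intro pair_measure_distr)
  then have "P \<Otimes>\<^sub>M Q = distr (M \<Otimes>\<^sub>M N) (P \<Otimes>\<^sub>M Q) (\<lambda>(x, y). (f x, g y))"
    using P(1) Q(1) by metis
  then have "(\<integral>\<^sup>+ z. h z \<partial>(P \<Otimes>\<^sub>M Q)) =
      (\<integral>\<^sup>+ z. h z \<partial>distr (M \<Otimes>\<^sub>M N) (P \<Otimes>\<^sub>M Q) (\<lambda>(x, y). (f x, g y)))"
    by metis
  also have "\<dots> = (\<integral>\<^sup>+ (x, y). h (f x, g y) \<partial>(M \<Otimes>\<^sub>M N))"
    using h by (subst nn_integral_distr) (auto simp: case_prod_unfold)
  finally show ?thesis .
qed

text \<open>
  The target of the map is written as the image measure and not as $N$, so that the target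
  of every coordinate is a probability space; the sigma-algebra is the same.
\<close>
lemma PiM_distr_eq_distr_compose:
  assumes "finite I" "prob_space M" and f[measurable]: "f \<in> measurable M N"
  shows "(\<Pi>\<^sub>M i\<in>I. distr M N f) = distr (\<Pi>\<^sub>M i\<in>I. M) (\<Pi>\<^sub>M i\<in>I. distr M N f) (compose I f)"
proof -
  have "prob_space (distr M N f)" using assms by (intro prob_space.prob_space_distr)
  \<comment> \<open>As a target, a measure matters through its measurable sets only.\<close>
  moreover have "distr M (distr M N f) f = distr M N f" by (intro distr_cong) auto
  ultimately show ?thesis
    using distr_PiM_finite_prob_space'[of I "\<lambda>_. M" "\<lambda>_. distr M N f" f] assms by simp
qed

lemma hom_integral_distr:
  fixes g :: "'c \<times> 'd \<Rightarrow> ennreal"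
  assumes "prob_space \<mu>" "prob_space \<nu>" and G: "bipartite_graph G"
    and \<phi>[measurable]: "\<phi> \<in> measurable \<mu> M" and \<psi>[measurable]: "\<psi> \<in> measurable \<nu> N"
    and g[measurable]: "g \<in> borel_measurable (M \<Otimes>\<^sub>M N)"
  shows "hom_integral G (distr \<mu> M \<phi>) (distr \<nu> N \<psi>) g = hom_integral G \<mu> \<nu> (\<lambda>(x, y). g (\<phi> x, \<psi> y))"
proof -
  let ?L = "lverts G" and ?R = "rverts G"
  have fin: "finite ?L" "finite ?R" and E: "set_mset (bedges G) \<subseteq> ?L \<times> ?R"
    using G by (auto simp: bipartite_graph_def)
  have "hom_integral G (distr \<mu> M \<phi>) (distr \<nu> N \<psi>) g =
     (\<integral>\<^sup>+ (x, y). (case (compose ?L \<phi> x, compose ?R \<psi> y) of (x, y) \<Rightarrow>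
        \<Prod>e\<in>#bedges G. g (x (fst e), y (snd e))) \<partial>((\<Pi>\<^sub>M t\<in>?L. \<mu>) \<Otimes>\<^sub>M (\<Pi>\<^sub>M r\<in>?R. \<nu>)))"
    unfolding hom_integral_def
  proof (rule nn_integral_pair_of_images[where f = "compose ?L \<phi>" and g = "compose ?R \<psi>"])
    have "prob_space (\<Pi>\<^sub>M r\<in>?R. distr \<nu> N \<psi>)"
      using assms by (intro prob_space_PiM prob_space.prob_space_distr)
    then show "sigma_finite_measure (\<Pi>\<^sub>M r\<in>?R. distr \<nu> N \<psi>)"
      by (simp add: prob_space_imp_sigma_finite)
    show "(\<lambda>(x, y). \<Prod>e\<in>#bedges G. g (x (fst e), y (snd e))) \<in> borel_measurable
        ((\<Pi>\<^sub>M t\<in>?L. distr \<mu> M \<phi>) \<Otimes>\<^sub>M (\<Pi>\<^sub>M r\<in>?R. distr \<nu> N \<psi>))"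
      using E by (intro borel_measurable_prod_mset_edges) measurable
    show "(\<Pi>\<^sub>M t\<in>?L. distr \<mu> M \<phi>) = distr (\<Pi>\<^sub>M t\<in>?L. \<mu>) (\<Pi>\<^sub>M t\<in>?L. distr \<mu> M \<phi>) (compose ?L \<phi>)"
      using fin assms by (intro PiM_distr_eq_distr_compose)
    show "(\<Pi>\<^sub>M r\<in>?R. distr \<nu> N \<psi>) = distr (\<Pi>\<^sub>M r\<in>?R. \<nu>) (\<Pi>\<^sub>M r\<in>?R. distr \<nu> N \<psi>) (compose ?R \<psi>)"
      using fin assms by (intro PiM_distr_eq_distr_compose)
  qed (simp_all add: compose_def[abs_def])
  also have "\<dots> = hom_integral G \<mu> \<nu> (\<lambda>(x, y). g (\<phi> x, \<psi> y))"
    unfolding hom_integral_def by (intro nn_integral_cong)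
      (auto simp: compose_def dest: bipartite_graph_edgeD[OF G] intro!: arg_cong[where f = prod_mset] image_mset_cong)
  finally show ?thesis .
qed

lemma hom_integral_cong:
  assumes G: "bipartite_graph G"
    and eq: "\<And>x y. x \<in> space \<mu> \<Longrightarrow> y \<in> space \<nu> \<Longrightarrow> f (x, y) = g (x, y)"
  shows "hom_integral G \<mu> \<nu> f = hom_integral G \<mu> \<nu> g"
  unfolding hom_integral_def
  by (intro nn_integral_cong)
    (auto simp: space_pair_measure space_PiM dest: bipartite_graph_edgeD[OF G]
      intro!: arg_cong[where f = prod_mset] image_mset_cong eq)

text \<open>
  The measures and the function on the real plane do not depend on the graph, so the integrals of
  $G$ and of $H$ are transported together.
\<close>
lemma hom_integral_realized_on_reals:
  fixes \<mu> :: "'a measure" and \<nu> :: "'b measure" and w :: "'a \<times> 'b \<Rightarrow> real"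
  assumes "prob_space \<mu>" "prob_space \<nu>" and w[measurable]: "w \<in> borel_measurable (\<mu> \<Otimes>\<^sub>M \<nu>)"
  obtains \<mu>' \<nu>' :: "real measure" and w' :: "real \<times> real \<Rightarrow> real" where
    "prob_space \<mu>'" "prob_space \<nu>'" "w' \<in> borel_measurable (\<mu>' \<Otimes>\<^sub>M \<nu>')"
    "\<And>G :: 'v bigraph. bipartite_graph G \<Longrightarrow>
      hom_integral G \<mu>' \<nu>' (\<lambda>z. ennreal \<bar>w' z\<bar>) = hom_integral G \<mu> \<nu> (\<lambda>z. ennreal \<bar>w z\<bar>)"
proof -
  have "(\<lambda>z. ennreal \<bar>w z\<bar>) \<in> borel_measurable (\<mu> \<Otimes>\<^sub>M \<nu>)" by measurable
  then obtain \<phi> :: "'a \<Rightarrow> real" and \<psi> :: "'b \<Rightarrow> real" and g :: "real \<times> real \<Rightarrow> ennreal" where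
    \<phi>: "\<phi> \<in> borel_measurable \<mu>" and \<psi>: "\<psi> \<in> borel_measurable \<nu>"
    and g: "g \<in> borel_measurable (borel \<Otimes>\<^sub>M borel)"
    and eq: "\<And>x y. x \<in> space \<mu> \<Longrightarrow> y \<in> space \<nu> \<Longrightarrow> ennreal \<bar>w (x, y)\<bar> = g (\<phi> x, \<psi> y)"
    by (rule borel_measurable_pair_factors_through_reals) blast
  let ?w = "\<lambda>z. enn2real (g z)"
  note [measurable] = g
  have w': "?w \<in> borel_measurable (borel \<Otimes>\<^sub>M borel)" by measurable
  show ?thesis
  proof (rule that)
    show "prob_space (distr \<mu> borel \<phi>)" "prob_space (distr \<nu> borel \<psi>)"
      using assms \<phi> \<psi> by (auto intro: prob_space.prob_space_distr)
    show "?w \<in> borel_measurable (distr \<mu> borel \<phi> \<Otimes>\<^sub>M distr \<nu> borel \<psi>)"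
      using w' by (simp cong: measurable_cong_sets sets_pair_measure_cong)
    fix G :: "'v bigraph" assume G: "bipartite_graph G"
    have "hom_integral G (distr \<mu> borel \<phi>) (distr \<nu> borel \<psi>) (\<lambda>z. ennreal \<bar>?w z\<bar>) =
        hom_integral G \<mu> \<nu> (\<lambda>(x, y). ennreal \<bar>?w (\<phi> x, \<psi> y)\<bar>)"
      by (intro hom_integral_distr assms G \<phi> \<psi>) measurable
    also have "\<dots> = hom_integral G \<mu> \<nu> (\<lambda>z. ennreal \<bar>w z\<bar>)"
      by (intro hom_integral_cong G) (simp flip: eq)
    finally show "hom_integral G (distr \<mu> borel \<phi>) (distr \<nu> borel \<psi>) (\<lambda>z. ennreal \<bar>?w z\<bar>) =
        hom_integral G \<mu> \<nu> (\<lambda>z. ennreal \<bar>w z\<bar>)" .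
  qed
qed

text \<open>
  Integrating over the coordinate of a vertex without edges changes nothing, since all measures have
  mass 1. This lets a subgraph be integrated over the vertices of the larger graph.
\<close>
lemma hom_integral_vertex_superset:
  fixes f :: "'a \<times> 'b \<Rightarrow> ennreal"
  assumes "prob_space \<mu>" "prob_space \<nu>" and G: "bipartite_graph G"
    and "finite L" "finite R" and sub: "lverts G \<subseteq> L" "rverts G \<subseteq> R"
    and f: "f \<in> borel_measurable (\<mu> \<Otimes>\<^sub>M \<nu>)"
  shows "hom_integral G \<mu> \<nu> f =
    (\<integral>\<^sup>+ (x, y). (\<Prod>e\<in>#bedges G. f (x (fst e), y (snd e))) \<partial>((\<Pi>\<^sub>M t\<in>L. \<mu>) \<Otimes>\<^sub>M (\<Pi>\<^sub>M r\<in>R. \<nu>)))"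
proof -
  interpret L: product_prob_space "\<lambda>_. \<mu>" L using assms by (intro product_prob_spaceI)
  interpret R: product_prob_space "\<lambda>_. \<nu>" R using assms by (intro product_prob_spaceI)
  let ?L = "lverts G" and ?R = "rverts G"
  have E: "set_mset (bedges G) \<subseteq> ?L \<times> ?R" using G by (auto simp: bipartite_graph_def)
  have "hom_integral G \<mu> \<nu> f =
     (\<integral>\<^sup>+ (x, y). (case (restrict x ?L, restrict y ?R) of (x, y) \<Rightarrow>
        \<Prod>e\<in>#bedges G. f (x (fst e), y (snd e))) \<partial>((\<Pi>\<^sub>M t\<in>L. \<mu>) \<Otimes>\<^sub>M (\<Pi>\<^sub>M r\<in>R. \<nu>)))"
    unfolding hom_integral_def
  proof (rule nn_integral_pair_of_images)
    show "(\<Pi>\<^sub>M t\<in>?L. \<mu>) = distr (\<Pi>\<^sub>M t\<in>L. \<mu>) (\<Pi>\<^sub>M t\<in>?L. \<mu>) (\<lambda>x. restrict x ?L)"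
      using assms by (intro L.distr_restrict) auto
    show "(\<Pi>\<^sub>M t\<in>?R. \<nu>) = distr (\<Pi>\<^sub>M t\<in>R. \<nu>) (\<Pi>\<^sub>M t\<in>?R. \<nu>) (\<lambda>x. restrict x ?R)"
      using assms by (intro R.distr_restrict) auto
    show "sigma_finite_measure (\<Pi>\<^sub>M r\<in>?R. \<nu>)"
      using assms by (intro prob_space_imp_sigma_finite prob_space_PiM)
  qed (use E f sub in \<open>auto intro!: borel_measurable_prod_mset_edges measurable_restrict_subset\<close>)
  also have "\<dots> = (\<integral>\<^sup>+ (x, y). (\<Prod>e\<in>#bedges G. f (x (fst e), y (snd e))) \<partial>((\<Pi>\<^sub>M t\<in>L. \<mu>) \<Otimes>\<^sub>M (\<Pi>\<^sub>M r\<in>R. \<nu>)))"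
    by (intro nn_integral_cong) (auto dest: bipartite_graph_edgeD[OF G] intro!: arg_cong[where f = prod_mset] image_mset_cong)
  finally show ?thesis .
qed

section \<open>Homomorphism integrals of tensor squares\<close>

text \<open>
  A family of independent pairs is a pair of independent families. On a box with arbitrary measurable
  sides $A_i$ in the product of $M$ and $N$, both measures are evaluated by Fubini's theorem: the
  integrand is a product over $i$, for fixed first coordinates as well as after integrating out the
  second ones.
\<close>
lemma PiM_pair_eq_distr:
  assumes "finite I" "prob_space M" "prob_space N"
  shows "(\<Pi>\<^sub>M i\<in>I. M \<Otimes>\<^sub>M N) =
    distr ((\<Pi>\<^sub>M i\<in>I. M) \<Otimes>\<^sub>M (\<Pi>\<^sub>M i\<in>I. N)) (\<Pi>\<^sub>M i\<in>I. M \<Otimes>\<^sub>M N) (\<lambda>(x, y). \<lambda>i\<in>I. (x i, y i))"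
proof -
  interpret M: prob_space M by fact
  interpret N: prob_space N by fact
  interpret MN: pair_prob_space M N ..
  interpret PM: product_prob_space "\<lambda>_. M" I using assms by (intro product_prob_spaceI)
  interpret PN: product_prob_space "\<lambda>_. N" I using assms by (intro product_prob_spaceI)
  interpret PMN: product_prob_space "\<lambda>_. M \<Otimes>\<^sub>M N" I
    by (intro product_prob_spaceI) (rule MN.prob_space_axioms)
  let ?P = "(\<Pi>\<^sub>M i\<in>I. M) \<Otimes>\<^sub>M (\<Pi>\<^sub>M i\<in>I. N)"
  let ?zip = "\<lambda>(x, y). \<lambda>i\<in>I. (x i, y i)"
  have zip[measurable]: "?zip \<in> measurable ?P (\<Pi>\<^sub>M i\<in>I. M \<Otimes>\<^sub>M N)" by measurable
  show ?thesis
  proof (rule PMN.PiM_eqI[OF assms(1), symmetric])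
    fix A assume A[measurable]: "\<And>i. i \<in> I \<Longrightarrow> A i \<in> sets (M \<Otimes>\<^sub>M N)"
    have "emeasure (distr ?P (\<Pi>\<^sub>M i\<in>I. M \<Otimes>\<^sub>M N) ?zip) (Pi\<^sub>E I A) =
        (\<integral>\<^sup>+ z. indicator (Pi\<^sub>E I A) (?zip z) \<partial>?P)"
      using assms(1) A by (subst nn_integral_indicator[symmetric])
        (auto simp del: nn_integral_indicator intro!: nn_integral_distr sets_PiM_I_finite)
    also have "\<dots> = (\<integral>\<^sup>+ z. (\<Prod>i\<in>I. indicator (A i) (fst z i, snd z i)) \<partial>?P)"
      using assms(1) by (intro nn_integral_cong)
        (auto simp: indicator_def PiE_iff extensional_def restrict_def prod_zero_iff split: if_splits)
    also have "\<dots> = (\<integral>\<^sup>+ x. \<integral>\<^sup>+ y. (\<Prod>i\<in>I. indicator (A i) (x i, y i)) \<partial>(\<Pi>\<^sub>M i\<in>I. N) \<partial>(\<Pi>\<^sub>M i\<in>I. M))"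
      by (subst PN.nn_integral_fst[symmetric]) simp_all
    also have "\<dots> = (\<integral>\<^sup>+ x. (\<Prod>i\<in>I. \<integral>\<^sup>+ b. indicator (A i) (x i, b) \<partial>N) \<partial>(\<Pi>\<^sub>M i\<in>I. M))"
    proof (intro nn_integral_cong PN.product_nn_integral_prod[OF assms(1)])
      fix x i assume "x \<in> space (\<Pi>\<^sub>M i\<in>I. M)" and [simp]: "i \<in> I"
      then have [measurable]: "x i \<in> space M" by (auto simp: space_PiM)
      show "(\<lambda>b. indicator (A i) (x i, b) :: ennreal) \<in> borel_measurable N" by measurable
    qed
    also have "\<dots> = (\<Prod>i\<in>I. \<integral>\<^sup>+ a. \<integral>\<^sup>+ b. indicator (A i) (a, b) \<partial>N \<partial>M)"
      by (intro PM.product_nn_integral_prod[OF assms(1)]) measurable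
    also have "\<dots> = (\<Prod>i\<in>I. emeasure (M \<Otimes>\<^sub>M N) (A i))"
      by (intro prod.cong refl) (subst N.nn_integral_fst, simp_all)
    finally show "emeasure (distr ?P (\<Pi>\<^sub>M i\<in>I. M \<Otimes>\<^sub>M N) ?zip) (Pi\<^sub>E I A) =
        (\<Prod>i\<in>I. emeasure (M \<Otimes>\<^sub>M N) (A i))" .
  qed simp
qed

lemma nn_integral_tensor_product:
  fixes F :: "'a \<times> 'c \<Rightarrow> ennreal" and F' :: "'b \<times> 'd \<Rightarrow> ennreal"
  assumes "sigma_finite_measure M'" "sigma_finite_measure N" "sigma_finite_measure N'"
    and [measurable]: "F \<in> borel_measurable (M \<Otimes>\<^sub>M N)" "F' \<in> borel_measurable (M' \<Otimes>\<^sub>M N')"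
  shows "(\<integral>\<^sup>+ ((a, b), (c, d)). F (a, c) * F' (b, d) \<partial>((M \<Otimes>\<^sub>M M') \<Otimes>\<^sub>M (N \<Otimes>\<^sub>M N'))) =
    (\<integral>\<^sup>+ z. F z \<partial>(M \<Otimes>\<^sub>M N)) * (\<integral>\<^sup>+ z. F' z \<partial>(M' \<Otimes>\<^sub>M N'))"
proof -
  interpret M': sigma_finite_measure M' by fact
  interpret N: sigma_finite_measure N by fact
  interpret N': sigma_finite_measure N' by fact
  interpret NN': pair_sigma_finite N N' ..
  have "(\<integral>\<^sup>+ ((a, b), (c, d)). F (a, c) * F' (b, d) \<partial>((M \<Otimes>\<^sub>M M') \<Otimes>\<^sub>M (N \<Otimes>\<^sub>M N'))) =
     (\<integral>\<^sup>+ a. \<integral>\<^sup>+ b. \<integral>\<^sup>+ z. F (a, fst z) * F' (b, snd z) \<partial>(N \<Otimes>\<^sub>M N') \<partial>M' \<partial>M)"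
    by (simp add: case_prod_unfold NN'.P.nn_integral_fst[symmetric] M'.nn_integral_fst[symmetric])
  also have "\<dots> = (\<integral>\<^sup>+ a. \<integral>\<^sup>+ b. \<integral>\<^sup>+ c. \<integral>\<^sup>+ d. F (a, c) * F' (b, d) \<partial>N' \<partial>N \<partial>M' \<partial>M)"
  proof (intro nn_integral_cong)
    fix a b assume [measurable]: "a \<in> space M" "b \<in> space M'"
    show "(\<integral>\<^sup>+ z. F (a, fst z) * F' (b, snd z) \<partial>(N \<Otimes>\<^sub>M N')) = (\<integral>\<^sup>+ c. \<integral>\<^sup>+ d. F (a, c) * F' (b, d) \<partial>N' \<partial>N)"
      by (subst N'.nn_integral_fst[symmetric]) simp_all
  qed
  also have "\<dots> = (\<integral>\<^sup>+ a. \<integral>\<^sup>+ b. (\<integral>\<^sup>+ c. F (a, c) \<partial>N) * (\<integral>\<^sup>+ d. F' (b, d) \<partial>N') \<partial>M' \<partial>M)"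
    by (intro nn_integral_cong) (simp add: nn_integral_cmult nn_integral_multc)
  also have "\<dots> = (\<integral>\<^sup>+ a. \<integral>\<^sup>+ c. F (a, c) \<partial>N \<partial>M) * (\<integral>\<^sup>+ b. \<integral>\<^sup>+ d. F' (b, d) \<partial>N' \<partial>M')"
    by (simp add: nn_integral_cmult nn_integral_multc)
  finally show ?thesis by (simp add: N.nn_integral_fst N'.nn_integral_fst)
qed

lemma hom_integral_tensor_square:
  fixes f :: "'a \<times> 'b \<Rightarrow> ennreal"
  assumes "prob_space \<mu>" "prob_space \<nu>" and G: "bipartite_graph G"
    and f[measurable]: "f \<in> borel_measurable (\<mu> \<Otimes>\<^sub>M \<nu>)"
  shows "hom_integral G (\<mu> \<Otimes>\<^sub>M \<mu>) (\<nu> \<Otimes>\<^sub>M \<nu>) (\<lambda>((a, a'), (b, b')). f (a, b) * f (a', b'))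
    = (hom_integral G \<mu> \<nu> f)\<^sup>2"
proof -
  let ?L = "lverts G" and ?R = "rverts G"
  let ?X = "\<Pi>\<^sub>M t\<in>?L. \<mu>" and ?Y = "\<Pi>\<^sub>M r\<in>?R. \<nu>"
  let ?ff = "\<lambda>((a, a'), (b, b')). f (a, b) * f (a', b')"
  let ?zip = "\<lambda>I (x, y). \<lambda>i\<in>I. (x i, y i)"
  let ?F = "\<lambda>(x, y). \<Prod>e\<in>#bedges G. f (x (fst e), y (snd e))"
  have fin: "finite ?L" "finite ?R" and E: "set_mset (bedges G) \<subseteq> ?L \<times> ?R"
    using G by (auto simp: bipartite_graph_def)
  have sf: "sigma_finite_measure ?X" "sigma_finite_measure ?Y"
    using assms by (auto intro!: prob_space_imp_sigma_finite prob_space_PiM)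
  have "prob_space (\<nu> \<Otimes>\<^sub>M \<nu>)" using assms by (intro prob_space_pair)
  have "hom_integral G (\<mu> \<Otimes>\<^sub>M \<mu>) (\<nu> \<Otimes>\<^sub>M \<nu>) ?ff =
     (\<integral>\<^sup>+ (x, y). (case (?zip ?L x, ?zip ?R y) of (x, y) \<Rightarrow>
        \<Prod>e\<in>#bedges G. ?ff (x (fst e), y (snd e))) \<partial>((?X \<Otimes>\<^sub>M ?X) \<Otimes>\<^sub>M (?Y \<Otimes>\<^sub>M ?Y)))"
    unfolding hom_integral_def
  proof (rule nn_integral_pair_of_images)
    show "sigma_finite_measure (\<Pi>\<^sub>M r\<in>?R. \<nu> \<Otimes>\<^sub>M \<nu>)"
      using \<open>prob_space (\<nu> \<Otimes>\<^sub>M \<nu>)\<close> by (intro prob_space_imp_sigma_finite prob_space_PiM)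
    have "?ff \<in> borel_measurable ((\<mu> \<Otimes>\<^sub>M \<mu>) \<Otimes>\<^sub>M (\<nu> \<Otimes>\<^sub>M \<nu>))" by (simp add: case_prod_unfold)
    then show "(\<lambda>(x, y). \<Prod>e\<in>#bedges G. ?ff (x (fst e), y (snd e))) \<in> borel_measurable
        ((\<Pi>\<^sub>M t\<in>?L. \<mu> \<Otimes>\<^sub>M \<mu>) \<Otimes>\<^sub>M (\<Pi>\<^sub>M r\<in>?R. \<nu> \<Otimes>\<^sub>M \<nu>))"
      using E by (intro borel_measurable_prod_mset_edges)
  qed (use fin assms in \<open>auto intro!: PiM_pair_eq_distr\<close>)
  also have "\<dots> = (\<integral>\<^sup>+ ((x, x'), (y, y')). ?F (x, y) * ?F (x', y') \<partial>((?X \<Otimes>\<^sub>M ?X) \<Otimes>\<^sub>M (?Y \<Otimes>\<^sub>M ?Y)))"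
    by (intro nn_integral_cong)
      (auto dest: bipartite_graph_edgeD[OF G] simp flip: prod_mset.distrib intro!: arg_cong[where f = prod_mset] image_mset_cong)
  also have "\<dots> = (hom_integral G \<mu> \<nu> f)\<^sup>2"
    unfolding hom_integral_def power2_eq_square
    by (intro nn_integral_tensor_product sf borel_measurable_prod_mset_edges[OF f E])
  finally show ?thesis .
qed

section \<open>The bound up to a constant\<close>

lemma ennreal_powr_inverse_le_iff:
  assumes "m > 0" "t \<ge> 0"
  shows "ennreal_powr a (1 / real m) \<le> ennreal t \<longleftrightarrow> a \<le> ennreal t ^ m"
proof (cases a)
  case (real r)
  have "r powr (1 / real m) = root m r" "root m (t ^ m) = t"
    using assms real by (simp_all add: root_powr_inverse[symmetric] real_root_power_cancel)
  then have "r powr (1 / real m) \<le> t \<longleftrightarrow> root m r \<le> root m (t ^ m)" by simp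
  also have "\<dots> \<longleftrightarrow> r \<le> t ^ m" using assms by simp
  finally show ?thesis using assms real by (simp add: ennreal_powr_def ennreal_power)
next
  case top
  then show ?thesis using assms by (simp add: ennreal_powr_def ennreal_power top_unique)
qed

lemma rnorm_le_iff:
  assumes "bedges H \<noteq> {#}" "t \<ge> 0"
  shows "rnorm H \<mu> \<nu> w \<le> ennreal t \<longleftrightarrow>
    hom_integral H \<mu> \<nu> (\<lambda>z. ennreal \<bar>w z\<bar>) \<le> ennreal t ^ size (bedges H)"
  using assms unfolding rnorm_def by (simp add: ennreal_powr_inverse_le_iff nonempty_has_size)

lemma hom_integral_const:
  assumes "prob_space \<mu>" "prob_space \<nu>"
  shows "hom_integral H \<mu> \<nu> (\<lambda>_. c) = c ^ size (bedges H)"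
proof -
  have "prob_space ((\<Pi>\<^sub>M t\<in>lverts H. \<mu>) \<Otimes>\<^sub>M (\<Pi>\<^sub>M r\<in>rverts H. \<nu>))"
    using assms by (intro prob_space_pair prob_space_PiM)
  then show ?thesis
    by (simp add: hom_integral_def case_prod_unfold prob_space.emeasure_space_1)
qed

text \<open>
  The triangle inequality for $|w|$ and the constant function $t$, both of which have norm at most $t$.
\<close>
lemma hom_integral_shift_le:
  assumes norm: "is_norm_rspace H \<mu> \<nu>" and "prob_space \<mu>" "prob_space \<nu>" and H: "bedges H \<noteq> {#}"
    and w: "w \<in> borel_measurable (\<mu> \<Otimes>\<^sub>M \<nu>)" and t: "t \<ge> 0"
    and le: "hom_integral H \<mu> \<nu> (\<lambda>z. ennreal \<bar>w z\<bar>) \<le> ennreal t ^ size (bedges H)"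
  shows "hom_integral H \<mu> \<nu> (\<lambda>z. ennreal \<bar>w z\<bar> + ennreal t) \<le> ennreal (2 * t) ^ size (bedges H)"
proof -
  have n1: "rnorm H \<mu> \<nu> (\<lambda>z. \<bar>w z\<bar>) \<le> ennreal t"
    using le by (simp add: rnorm_le_iff[OF H t])
  have n2: "rnorm H \<mu> \<nu> (\<lambda>z. t) \<le> ennreal t"
    using t by (simp add: rnorm_le_iff[OF H t] hom_integral_const[OF assms(2,3)])
  have sp: "(\<lambda>z. \<bar>w z\<bar>) \<in> rspace H \<mu> \<nu>" "(\<lambda>z. t) \<in> rspace H \<mu> \<nu>"
    using w n1 n2 by (auto simp: rspace_def intro: le_less_trans)
  from norm have triangle: "\<forall>u\<in>rspace H \<mu> \<nu>. \<forall>v\<in>rspace H \<mu> \<nu>.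
      rnorm H \<mu> \<nu> (\<lambda>z. u z + v z) \<le> rnorm H \<mu> \<nu> u + rnorm H \<mu> \<nu> v"
    by (simp add: is_norm_rspace_def)
  have "rnorm H \<mu> \<nu> (\<lambda>z. \<bar>w z\<bar> + t) \<le> rnorm H \<mu> \<nu> (\<lambda>z. \<bar>w z\<bar>) + rnorm H \<mu> \<nu> (\<lambda>z. t)"
    by (rule triangle[THEN bspec, OF sp(1), THEN bspec, OF sp(2)])
  also have "\<dots> \<le> ennreal t + ennreal t" using n1 n2 by (rule add_mono)
  also have "\<dots> = ennreal (2 * t)" using t by (simp flip: ennreal_plus)
  finally show ?thesis using t by (simp add: rnorm_le_iff[OF H] flip: ennreal_plus)
qed

lemma prod_mset_mono_ennreal:
  fixes f g :: "'a \<Rightarrow> ennreal"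
  assumes "\<And>x. x \<in># A \<Longrightarrow> f x \<le> g x"
  shows "(\<Prod>x\<in>#A. f x) \<le> (\<Prod>x\<in>#A. g x)"
  using assms by (induction A) (auto intro: mult_mono)

text \<open>
  Every factor $f + c$ is bounded below by $f$ on the edges of $G$ and by $c$ on the remaining edges.
\<close>
lemma hom_integral_subgraph_le_shift:
  fixes f :: "'a \<times> 'b \<Rightarrow> ennreal" and G H :: "'c bigraph"
  assumes "prob_space \<mu>" "prob_space \<nu>" and sub: "bipartite_subgraph G H"
    and f: "f \<in> borel_measurable (\<mu> \<Otimes>\<^sub>M \<nu>)"
  shows "hom_integral G \<mu> \<nu> f * c ^ (size (bedges H) - size (bedges G))
    \<le> hom_integral H \<mu> \<nu> (\<lambda>z. f z + c)"
proof -
  have GH: "bipartite_graph G" "bipartite_graph H" "lverts G \<subseteq> lverts H" "rverts G \<subseteq> rverts H"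
    "bedges G \<subseteq># bedges H"
    using sub by (auto simp: bipartite_subgraph_def)
  define D where "D = bedges H - bedges G"
  have D: "bedges H = bedges G + D" "size D = size (bedges H) - size (bedges G)"
    using GH(5) by (auto simp: D_def size_Diff_submset)
  have fin: "finite (lverts H)" "finite (rverts H)" and E: "set_mset (bedges G) \<subseteq> lverts H \<times> rverts H"
    using GH by (auto simp: bipartite_graph_def)
  let ?P = "(\<Pi>\<^sub>M t\<in>lverts H. \<mu>) \<Otimes>\<^sub>M (\<Pi>\<^sub>M r\<in>rverts H. \<nu>)"
  have "hom_integral G \<mu> \<nu> f * c ^ size D =
      (\<integral>\<^sup>+ z. (case z of (x, y) \<Rightarrow> \<Prod>e\<in>#bedges G. f (x (fst e), y (snd e))) * c ^ size D \<partial>?P)"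
    unfolding hom_integral_vertex_superset[OF assms(1,2) GH(1) fin GH(3,4) f]
    by (intro nn_integral_multc[symmetric] borel_measurable_prod_mset_edges f E)
  also have "\<dots> \<le> hom_integral H \<mu> \<nu> (\<lambda>z. f z + c)"
    unfolding hom_integral_def
  proof (intro nn_integral_mono)
    fix z
    obtain x :: "'c \<Rightarrow> 'a" and y :: "'c \<Rightarrow> 'b" where z: "z = (x, y)" by force
    have "(\<Prod>e\<in>#bedges G. f (x (fst e), y (snd e))) * (\<Prod>e\<in>#D. c)
        \<le> (\<Prod>e\<in>#bedges G. f (x (fst e), y (snd e)) + c) * (\<Prod>e\<in>#D. f (x (fst e), y (snd e)) + c)"
      by (intro mult_mono prod_mset_mono_ennreal) auto
    then show "(case z of (x, y) \<Rightarrow> \<Prod>e\<in>#bedges G. f (x (fst e), y (snd e))) * c ^ size D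
        \<le> (case z of (x, y) \<Rightarrow> \<Prod>e\<in>#bedges H. f (x (fst e), y (snd e)) + c)"
      by (simp add: z D(1))
  qed
  finally show ?thesis by (simp add: D(2))
qed

lemma hom_integral_subgraph_le_const_mult:
  assumes "is_norm_rspace H \<mu> \<nu>" and prob: "prob_space \<mu>" "prob_space \<nu>"
    and sub: "bipartite_subgraph G H" and ne: "bedges G \<noteq> {#}"
    and w[measurable]: "w \<in> borel_measurable (\<mu> \<Otimes>\<^sub>M \<nu>)" and t: "t > 0"
    and le: "hom_integral H \<mu> \<nu> (\<lambda>z. ennreal \<bar>w z\<bar>) \<le> ennreal t ^ size (bedges H)"
  shows "hom_integral G \<mu> \<nu> (\<lambda>z. ennreal \<bar>w z\<bar>) \<le> 2 ^ size (bedges H) * ennreal t ^ size (bedges G)"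
proof -
  let ?m = "size (bedges H)" and ?k = "size (bedges G)"
  let ?h = "hom_integral G \<mu> \<nu> (\<lambda>z. ennreal \<bar>w z\<bar>)"
  have "bedges G \<subseteq># bedges H" using sub by (simp add: bipartite_subgraph_def)
  then have "?k \<le> ?m" "bedges H \<noteq> {#}" using ne by (auto simp: size_mset_mono)
  have "?h * ennreal t ^ (?m - ?k) \<le> hom_integral H \<mu> \<nu> (\<lambda>z. ennreal \<bar>w z\<bar> + ennreal t)"
    by (intro hom_integral_subgraph_le_shift prob sub) measurable
  also have "\<dots> \<le> ennreal (2 * t) ^ ?m"
    using assms \<open>bedges H \<noteq> {#}\<close> by (intro hom_integral_shift_le) auto
  also have "\<dots> = 2 ^ ?m * ennreal t ^ ?k * ennreal t ^ (?m - ?k)"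
    using t \<open>?k \<le> ?m\<close> by (simp add: ennreal_mult power_mult_distrib mult.assoc flip: power_add)
  finally have "ennreal t ^ (?m - ?k) * ?h \<le> ennreal t ^ (?m - ?k) * (2 ^ ?m * ennreal t ^ ?k)"
    by (simp add: mult_ac)
  moreover have "ennreal t ^ (?m - ?k) \<noteq> 0" "ennreal t ^ (?m - ?k) \<noteq> top"
    using t by (simp_all add: ennreal_power)
  ultimately show ?thesis by (simp add: ennreal_mult_le_mult_iff)
qed

section \<open>Removing the constant\<close>

text \<open>
  Each step of the induction replaces $w$ by $w \otimes w$, carried back to the real plane, and $t$
  by $t^2$. The constant $2^m$ stays the same, while both other sides are squared.
\<close>
lemma hom_integral_subgraph_power_le:
  fixes \<mu> \<nu> :: "real measure" and w :: "real \<times> real \<Rightarrow> real" and G H :: "'v bigraph"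
  assumes norm: "always_norm H" and sub: "bipartite_subgraph G H" and ne: "bedges G \<noteq> {#}"
    and "prob_space \<mu>" "prob_space \<nu>" "w \<in> borel_measurable (\<mu> \<Otimes>\<^sub>M \<nu>)" and "t > 0"
    and "hom_integral H \<mu> \<nu> (\<lambda>z. ennreal \<bar>w z\<bar>) \<le> ennreal t ^ size (bedges H)"
  shows "hom_integral G \<mu> \<nu> (\<lambda>z. ennreal \<bar>w z\<bar>) ^ (2 ^ n)
    \<le> 2 ^ size (bedges H) * (ennreal t ^ size (bedges G)) ^ (2 ^ n)"
  using assms(4-)
proof (induction n arbitrary: \<mu> \<nu> w t)
  case 0
  then have "is_norm_rspace H \<mu> \<nu>" using norm by (auto simp: always_norm_def)
  then show ?case using 0 sub ne by (simp add: hom_integral_subgraph_le_const_mult)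
next
  case (Suc n)
  note [measurable] = Suc.prems(3)
  have GH: "bipartite_graph G" "bipartite_graph H" using sub by (auto simp: bipartite_subgraph_def)
  let ?ww = "\<lambda>((a, a'), (b, b')). w (a, b) * w (a', b')"
  have "prob_space (\<mu> \<Otimes>\<^sub>M \<mu>)" "prob_space (\<nu> \<Otimes>\<^sub>M \<nu>)"
    using Suc.prems by (auto intro: prob_space_pair)
  moreover have "?ww \<in> borel_measurable ((\<mu> \<Otimes>\<^sub>M \<mu>) \<Otimes>\<^sub>M (\<nu> \<Otimes>\<^sub>M \<nu>))"
    by (simp add: case_prod_unfold)
  ultimately obtain \<mu>' \<nu>' :: "real measure" and w' where
    real: "prob_space \<mu>'" "prob_space \<nu>'" "w' \<in> borel_measurable (\<mu>' \<Otimes>\<^sub>M \<nu>')"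
    and eq: "\<And>K :: 'v bigraph. bipartite_graph K \<Longrightarrow> hom_integral K \<mu>' \<nu>' (\<lambda>z. ennreal \<bar>w' z\<bar>) =
      hom_integral K (\<mu> \<Otimes>\<^sub>M \<mu>) (\<nu> \<Otimes>\<^sub>M \<nu>) (\<lambda>z. ennreal \<bar>?ww z\<bar>)"
    by (rule hom_integral_realized_on_reals) blast
  have "(\<lambda>z. ennreal \<bar>?ww z\<bar>) = (\<lambda>((a, a'), (b, b')). ennreal \<bar>w (a, b)\<bar> * ennreal \<bar>w (a', b')\<bar>)"
    by (auto simp: abs_mult ennreal_mult)
  then have sq: "hom_integral K \<mu>' \<nu>' (\<lambda>z. ennreal \<bar>w' z\<bar>) =
      (hom_integral K \<mu> \<nu> (\<lambda>z. ennreal \<bar>w z\<bar>))\<^sup>2" if "bipartite_graph K" for K :: "'v bigraph"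
    using hom_integral_tensor_square[OF Suc.prems(1,2) that, of "\<lambda>z. ennreal \<bar>w z\<bar>"] eq[OF that]
    by simp
  have "(hom_integral H \<mu> \<nu> (\<lambda>z. ennreal \<bar>w z\<bar>))\<^sup>2 \<le> (ennreal t ^ size (bedges H))\<^sup>2"
    using Suc.prems(5) by (intro power_mono) auto
  then have "hom_integral H \<mu>' \<nu>' (\<lambda>z. ennreal \<bar>w' z\<bar>) \<le> ennreal (t\<^sup>2) ^ size (bedges H)"
    using \<open>t > 0\<close> by (simp add: sq GH ennreal_power mult.commute flip: power_mult)
  with Suc.IH[OF real, of "t\<^sup>2"] \<open>t > 0\<close>
  have "hom_integral G \<mu>' \<nu>' (\<lambda>z. ennreal \<bar>w' z\<bar>) ^ (2 ^ n)
      \<le> 2 ^ size (bedges H) * (ennreal (t\<^sup>2) ^ size (bedges G)) ^ (2 ^ n)"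
    by simp
  then show ?case
    using \<open>t > 0\<close> by (simp add: sq GH ennreal_power mult_ac flip: power_mult)
qed

text \<open>
  Otherwise the powers of $a / b > 1$ would be bounded by $C$.
\<close>
lemma ennreal_le_if_powers_le_const_mult:
  fixes a C :: ennreal
  assumes "C < \<infinity>" "b > 0" and le: "\<And>n. a ^ (2 ^ n) \<le> C * ennreal b ^ (2 ^ n)"
  shows "a \<le> ennreal b"
proof -
  obtain c where c: "C = ennreal c" "c \<ge> 0" using assms(1) by (cases C) auto
  have "a < \<infinity>" using le[of 0] c assms(2) by (auto simp flip: ennreal_mult intro: le_less_trans)
  then obtain r where r: "a = ennreal r" "r \<ge> 0" by (cases a) auto
  have le': "r ^ (2 ^ n) \<le> c * b ^ (2 ^ n)" for n
    using le[of n] r c assms(2) by (simp add: ennreal_power flip: ennreal_mult)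
  have "r \<le> b"
  proof (rule ccontr)
    assume "\<not> r \<le> b"
    then have q: "r / b > 1" using assms(2) by simp
    then obtain n where "c < (r / b) ^ n" using real_arch_pow by blast
    also have "\<dots> \<le> (r / b) ^ (2 ^ n)" using q by (intro power_increasing) auto
    also have "\<dots> \<le> c" using le'[of n] assms(2) by (simp add: power_divide divide_le_eq)
    finally show False by simp
  qed
  then show ?thesis by (simp add: r ennreal_leI)
qed

theorem theorem2p14:
  fixes \<mu> :: "'a measure" and \<nu> :: "'b measure"
    and H G :: "'v bigraph"
    and w :: "'a \<times> 'b \<Rightarrow> real"
  assumes "prob_space \<mu>" and "prob_space \<nu>"
    and "bipartite_graph H"
    and "always_norm H"
    and "bipartite_subgraph G H"
    and "bedges G \<noteq> {#}"
    and "w \<in> borel_measurable (\<mu> \<Otimes>\<^sub>M \<nu>)"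
  shows "rnorm H \<mu> \<nu> w \<ge> rnorm G \<mu> \<nu> w"
proof (rule ennreal_le_epsilon)
  \<comment> \<open>The slack keeps the bound t on the norm positive even if the norm of w is 0.\<close>
  fix \<epsilon> :: real
  assume "rnorm H \<mu> \<nu> w < top" and "\<epsilon> > 0"
  then obtain s where s: "rnorm H \<mu> \<nu> w = ennreal s" "s \<ge> 0" by (cases "rnorm H \<mu> \<nu> w") auto
  define t where "t = s + \<epsilon>"
  have t: "t > 0" "rnorm H \<mu> \<nu> w + ennreal \<epsilon> = ennreal t"
    using s \<open>\<epsilon> > 0\<close> by (auto simp: t_def)
  have GH: "bipartite_graph G" "bedges H \<noteq> {#}"
    using assms(5,6) by (auto simp: bipartite_subgraph_def)
  obtain \<mu>' \<nu>' :: "real measure" and w' where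
    real: "prob_space \<mu>'" "prob_space \<nu>'" "w' \<in> borel_measurable (\<mu>' \<Otimes>\<^sub>M \<nu>')"
    and eq: "\<And>K :: 'v bigraph. bipartite_graph K \<Longrightarrow> hom_integral K \<mu>' \<nu>' (\<lambda>z. ennreal \<bar>w' z\<bar>) =
      hom_integral K \<mu> \<nu> (\<lambda>z. ennreal \<bar>w z\<bar>)"
    by (rule hom_integral_realized_on_reals[OF assms(1,2,7)]) blast
  have "rnorm H \<mu> \<nu> w \<le> ennreal t" using s \<open>\<epsilon> > 0\<close> by (simp add: t_def ennreal_leI)
  then have "hom_integral H \<mu>' \<nu>' (\<lambda>z. ennreal \<bar>w' z\<bar>) \<le> ennreal t ^ size (bedges H)"
    using t(1) by (simp add: rnorm_le_iff[OF GH(2)] eq assms(3))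
  from hom_integral_subgraph_power_le[OF assms(4-6) real t(1) this]
  have "hom_integral G \<mu> \<nu> (\<lambda>z. ennreal \<bar>w z\<bar>) ^ (2 ^ n)
      \<le> 2 ^ size (bedges H) * ennreal (t ^ size (bedges G)) ^ (2 ^ n)" for n
    using t(1) by (simp add: eq GH(1) ennreal_power)
  then have "hom_integral G \<mu> \<nu> (\<lambda>z. ennreal \<bar>w z\<bar>) \<le> ennreal (t ^ size (bedges G))"
    by (rule ennreal_le_if_powers_le_const_mult[rotated 2]) (use t in \<open>auto simp: power_less_top_ennreal\<close>)
  then have "rnorm G \<mu> \<nu> w \<le> ennreal t"
    using t(1) by (simp add: rnorm_le_iff[OF assms(6)] ennreal_power)
  then show "rnorm G \<mu> \<nu> w \<le> rnorm H \<mu> \<nu> w + ennreal \<epsilon>" by (simp add: t(2))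
qed

end
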